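(* Let $G$ be a connected $(n-3)$-regular graph of order $n\ge 5$. Then $\gamma_p(G)=1$ if and only if there exists an edge $uv\in E(G)$ such that $|N[v]\setminus N[u]|=1$. Otherwise (i.e. if no such edge exists), $\gamma_p(G)=2$.
   Context: All graphs are finite, simple and undirected. $N[v]$ denotes the closed neighborhood of $v$ and $N[S]=\bigcup_{v\in S}N[v]$. For $U\subseteq V(G)$, the closure $cl(U)$ is the set obtained from $U$ by repeatedly applying, until no more changes are possible, the rule: if a vertex $u$ is in the current set and exactly one neighbor $w$ of $u$ is not in it, then add $w$. A set $S\subseteq V(G)$ is a power dominating set of $G$ if $cl(N[S])=V(G)$, and the power domination number $\gamma_p(G)$ is the minimum cardinality of a power dominating set. *)

theory Defs
  imports "Graph_Theory.Graph_Theory"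
begin

text \<open>
  A finite simple undirected graph is a digraph satisfying the locale predicate graph (finite,
  loopfree, symmetric, without parallel arcs): an undirected edge $uv$ is the pair of opposite
  arcs $(u,v)$ and $(v,u)$. Hence the out-degree of a vertex is its number of neighbours.
\<close>

definition closed_nbhd :: "('a, 'b) pre_digraph \<Rightarrow> 'a \<Rightarrow> 'a set" where
  "closed_nbhd G v = insert v {w. v \<rightarrow>\<^bsub>G\<^esub> w}"

definition closed_nbhd_set :: "('a, 'b) pre_digraph \<Rightarrow> 'a set \<Rightarrow> 'a set" where
  "closed_nbhd_set G S = (\<Union>v\<in>S. closed_nbhd G v)"

definition regular_graph :: "('a, 'b) pre_digraph \<Rightarrow> nat \<Rightarrow> bool" where
  "regular_graph G k \<longleftrightarrow> (\<forall>v\<in>verts G. out_degree G v = k)"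

definition forces :: "('a, 'b) pre_digraph \<Rightarrow> 'a set \<Rightarrow> 'a set \<Rightarrow> bool" where
  "forces G A B \<longleftrightarrow> (\<exists>u\<in>A. \<exists>w. {x. u \<rightarrow>\<^bsub>G\<^esub> x \<and> x \<notin> A} = {w} \<and> B = insert w A)"

definition is_forcing_closure :: "('a, 'b) pre_digraph \<Rightarrow> 'a set \<Rightarrow> 'a set \<Rightarrow> bool" where
  "is_forcing_closure G U C \<longleftrightarrow> (forces G)\<^sup>*\<^sup>* U C \<and> (\<nexists>B. forces G C B)"

definition cl :: "('a, 'b) pre_digraph \<Rightarrow> 'a set \<Rightarrow> 'a set" where
  "cl G U = (THE C. is_forcing_closure G U C)"

text \<open>
  The definite description denotes: forcing terminates, and its final set does not depend on
  the order in which the rule is applied.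
\<close>

lemma forces_rtranclp_increasing:
  assumes "(forces G)\<^sup>*\<^sup>* U A"
  shows "U \<subseteq> A"
  using assms by (induction rule: rtranclp_induct) (auto simp: forces_def)

lemma forces_rtranclp_subset_terminal:
  assumes "(forces G)\<^sup>*\<^sup>* U A" and "U \<subseteq> C" and "\<nexists>B. forces G C B"
  shows "A \<subseteq> C"
  using assms(1)
proof (induction rule: rtranclp_induct)
  case base
  show ?case by (fact assms(2))
next
  case (step A B)
  from step.hyps(2) obtain u w where
    u: "u \<in> A" and w: "{x. u \<rightarrow>\<^bsub>G\<^esub> x \<and> x \<notin> A} = {w}" and B: "B = insert w A"
    unfolding forces_def by blast
  have "w \<in> C"
  proof (rule ccontr)
    assume "w \<notin> C"
    with w step.IH have "{x. u \<rightarrow>\<^bsub>G\<^esub> x \<and> x \<notin> C} = {w}" by blast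
    with u step.IH have "forces G C (insert w C)" unfolding forces_def by blast
    with assms(3) show False by blast
  qed
  with B step.IH show ?case by blast
qed

lemma is_forcing_closure_exists:
  assumes "finite (verts G)" and "wf_digraph G" and "U \<subseteq> verts G"
  shows "\<exists>C. is_forcing_closure G U C"
  using assms(3)
proof (induction "card (verts G - U)" arbitrary: U rule: less_induct)
  case less
  show ?case
  proof (cases "\<exists>B. forces G U B")
    case False
    then show ?thesis unfolding is_forcing_closure_def by blast
  next
    case True
    then obtain u w where w: "{x. u \<rightarrow>\<^bsub>G\<^esub> x \<and> x \<notin> U} = {w}" and f: "forces G U (insert w U)"
      unfolding forces_def by blast
    from w have "u \<rightarrow>\<^bsub>G\<^esub> w" and "w \<notin> U" by blast+
    with assms(2) have wv: "w \<in> verts G" by (blast dest: wf_digraph.adj_in_verts(2))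
    with \<open>w \<notin> U\<close> assms(1) have "card (verts G - insert w U) < card (verts G - U)"
      by (intro psubset_card_mono) auto
    with less.hyps[of "insert w U"] less.prems wv obtain C where "is_forcing_closure G (insert w U) C"
      by blast
    with f show ?thesis unfolding is_forcing_closure_def by (blast intro: converse_rtranclp_into_rtranclp)
  qed
qed

lemma is_forcing_closure_unique:
  assumes "is_forcing_closure G U C" and "is_forcing_closure G U D"
  shows "C = D"
  using assms forces_rtranclp_increasing forces_rtranclp_subset_terminal
  unfolding is_forcing_closure_def by (metis subset_antisym)

lemma cl_is_forcing_closure:
  assumes "finite (verts G)" and "wf_digraph G" and "U \<subseteq> verts G"
  shows "is_forcing_closure G U (cl G U)"
  unfolding cl_def using is_forcing_closure_exists[OF assms] is_forcing_closure_unique by (metis theI)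

definition power_dominating_set :: "('a, 'b) pre_digraph \<Rightarrow> 'a set \<Rightarrow> bool" where
  "power_dominating_set G S \<longleftrightarrow> S \<subseteq> verts G \<and> cl G (closed_nbhd_set G S) = verts G"

definition power_domination_number :: "('a, 'b) pre_digraph \<Rightarrow> nat" where
  "power_domination_number G = Min (card ` {S. power_dominating_set G S})"

end

theory Submission
  imports Defs
begin

text \<open>
  A vertex \<open>u\<close> of an \<open>(n - 3)\<close>-regular graph dominates everything except two vertices \<open>a\<close>, \<open>b\<close>.
  The last missing vertex of a set always gets forced, since it has a neighbour and that neighbour
  has nothing else left to observe (\<open>cl_eq_verts_if_one_missing\<close>). Two consequences settle the
  value of the power domination number.

  First, \<open>{u, a}\<close> is power dominating for every \<open>u\<close>, because it leaves at most \<open>b\<close> undominated;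
  so the number is at most two.

  Second, \<open>{u}\<close> is power dominating exactly when at least one forcing step can start from \<open>N[u]\<close>.
  Such a step is made by a vertex \<open>v\<close> that sees exactly one of \<open>a\<close>, \<open>b\<close>. It is not \<open>u\<close>, which sees
  neither, so it is a neighbour of \<open>u\<close> with \<open>|N[v] - N[u]| = 1\<close>. This is the stated edge condition
  (\<open>power_dominating_singleton_iff\<close>).
\<close>

lemma closed_nbhd_subset_verts:
  assumes "wf_digraph G" and "v \<in> verts G"
  shows "closed_nbhd G v \<subseteq> verts G"
  using assms by (auto simp: closed_nbhd_def dest: wf_digraph.adj_in_verts(2))

lemma card_out_nbhd_eq_out_degree:
  assumes "nomulti_digraph G"
  shows "card {w. v \<rightarrow>\<^bsub>G\<^esub> w} = out_degree G v"
proof -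
  interpret nomulti_digraph G by fact
  have "{w. v \<rightarrow>\<^bsub>G\<^esub> w} = head G ` out_arcs G v"
    by (auto simp: out_arcs_def arcs_ends_def arc_to_ends_def)
  moreover have "inj_on (head G) (out_arcs G v)"
    by (rule inj_onI) (auto intro: no_multi_arcs simp: arc_to_ends_def)
  ultimately show ?thesis by (simp add: card_image out_degree_def)
qed

text \<open>Forcing is confluent, so a first step can be chosen freely without changing the closure.\<close>

lemma cl_forces_step:
  assumes "finite (verts G)" and "wf_digraph G" and "U \<subseteq> verts G" and "forces G U B"
  shows "cl G B = cl G U"
proof -
  have "B \<subseteq> verts G"
    using assms(2-4) by (auto simp: forces_def dest: wf_digraph.adj_in_verts(2))
  then have "is_forcing_closure G B (cl G B)"
    using assms cl_is_forcing_closure by blast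
  then have "is_forcing_closure G U (cl G B)"
    using assms(4) unfolding is_forcing_closure_def by (blast intro: converse_rtranclp_into_rtranclp)
  then show ?thesis
    using cl_is_forcing_closure[OF assms(1-3)] is_forcing_closure_unique by blast
qed

lemma cl_eq_self_if_no_force:
  assumes "finite (verts G)" and "wf_digraph G" and "U \<subseteq> verts G" and "\<nexists>B. forces G U B"
  shows "cl G U = U"
  using cl_is_forcing_closure[OF assms(1-3)] is_forcing_closure_unique[of G U] assms(4)
  unfolding is_forcing_closure_def by blast

lemma cl_verts:
  assumes "finite (verts G)" and "wf_digraph G"
  shows "cl G (verts G) = verts G"
proof (rule cl_eq_self_if_no_force[OF assms subset_refl])
  have "{x. u \<rightarrow>\<^bsub>G\<^esub> x \<and> x \<notin> verts G} = {}" for u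
    using wf_digraph.adj_in_verts(2)[OF assms(2)] by blast
  then show "\<nexists>B. forces G (verts G) B" unfolding forces_def by (metis insert_not_empty)
qed

text \<open>
  A neighbour of the missing vertex lies in the set, as there are no loops, and it has no other
  neighbour outside, so it forces.
\<close>

lemma cl_eq_verts_if_one_missing:
  assumes "finite (verts G)" and "loopfree_digraph G" and "U \<subseteq> verts G"
    and missing: "verts G \<subseteq> insert b U" and nbr: "u \<rightarrow>\<^bsub>G\<^esub> b"
  shows "cl G U = verts G"
proof -
  interpret loopfree_digraph G by fact
  show ?thesis
  proof (cases "U = verts G")
    case True
    then show ?thesis using cl_verts assms(1) wf_digraph_axioms by metis
  next
    case False
    then have b: "b \<notin> U" "b \<in> verts G" and V: "verts G = insert b U"
      using assms(3) missing by blast+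
    have "u \<in> verts G" and "u \<noteq> b" using nbr adj_in_verts(1) adj_not_same by blast+
    then have "u \<in> U" using V by blast
    moreover have "{x. u \<rightarrow>\<^bsub>G\<^esub> x \<and> x \<notin> U} = {b}"
      using nbr b(1) V adj_in_verts(2) by blast
    ultimately have "forces G U (verts G)" unfolding forces_def V by blast
    then have "cl G (verts G) = cl G U"
      using cl_forces_step assms(1,3) wf_digraph_axioms by metis
    then show ?thesis using cl_verts[OF assms(1) wf_digraph_axioms] by simp
  qed
qed

lemma not_power_dominating_empty:
  assumes "finite (verts G)" and "wf_digraph G" and "verts G \<noteq> {}"
  shows "\<not> power_dominating_set G {}"
proof -
  have "cl G {} = {}"
    by (rule cl_eq_self_if_no_force[OF assms(1,2)]) (auto simp: forces_def)
  then show ?thesis using assms(3) by (auto simp: power_dominating_set_def closed_nbhd_set_def)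
qed

lemma finite_power_dominating_sets:
  assumes "finite (verts G)"
  shows "finite {S. power_dominating_set G S}"
  by (rule finite_subset[of _ "Pow (verts G)"]) (auto simp: assms power_dominating_set_def)

lemma power_domination_number_le:
  assumes "finite (verts G)" and "power_dominating_set G S"
  shows "power_domination_number G \<le> card S"
  using finite_power_dominating_sets[OF assms(1)] assms(2)
  by (simp add: power_domination_number_def)

lemma power_domination_number_attained:
  assumes "finite (verts G)" and "wf_digraph G"
  obtains S where "power_dominating_set G S" and "card S = power_domination_number G"
proof -
  have "closed_nbhd_set G (verts G) = verts G"
    using closed_nbhd_subset_verts[OF assms(2)] by (auto simp: closed_nbhd_set_def closed_nbhd_def)
  then have "power_dominating_set G (verts G)"
    using cl_verts[OF assms] by (simp add: power_dominating_set_def)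
  then have "card ` {S. power_dominating_set G S} \<noteq> {}" by blast
  then have "power_domination_number G \<in> card ` {S. power_dominating_set G S}"
    unfolding power_domination_number_def
    using finite_power_dominating_sets[OF assms(1)] by (intro Min_in) auto
  then show ?thesis using that by auto
qed

lemma power_domination_number_pos:
  assumes "finite (verts G)" and "wf_digraph G" and "verts G \<noteq> {}"
  shows "power_domination_number G \<ge> 1"
proof -
  obtain S where S: "power_dominating_set G S" "card S = power_domination_number G"
    using power_domination_number_attained[OF assms(1,2)] .
  then have "S \<noteq> {}" and "finite S"
    using not_power_dominating_empty[OF assms] assms(1) finite_subset
    by (auto simp: power_dominating_set_def)
  then have "card S > 0" by (simp add: card_gt_0_iff)
  then show ?thesis using S(2) by simp
qed

lemma power_domination_number_eq_1_iff:
  assumes "finite (verts G)" and "wf_digraph G" and "verts G \<noteq> {}"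
  shows "power_domination_number G = 1 \<longleftrightarrow> (\<exists>u. power_dominating_set G {u})"
proof
  assume "power_domination_number G = 1"
  then show "\<exists>u. power_dominating_set G {u}"
    using power_domination_number_attained[OF assms(1,2)] card_1_singletonE by metis
next
  assume "\<exists>u. power_dominating_set G {u}"
  then show "power_domination_number G = 1"
    using power_domination_number_le[OF assms(1)] power_domination_number_pos[OF assms]
    by (fastforce intro: antisym)
qed

text \<open>A closed neighbourhood has \<open>(n - 3) + 1\<close> elements, the vertex itself not being a neighbour.\<close>

lemma card_outside_closed_nbhd:
  assumes "digraph G" and "card (verts G) \<ge> 3"
    and "regular_graph G (card (verts G) - 3)" and "v \<in> verts G"
  shows "card (verts G - closed_nbhd G v) = 2"
proof -
  interpret digraph G by fact
  have sub: "closed_nbhd G v \<subseteq> verts G"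
    using closed_nbhd_subset_verts wf_digraph_axioms assms(4) by metis
  then have "finite {w. v \<rightarrow>\<^bsub>G\<^esub> w}"
    by (auto simp: closed_nbhd_def intro: finite_subset[OF _ finite_verts])
  moreover have "v \<notin> {w. v \<rightarrow>\<^bsub>G\<^esub> w}" using adj_not_same by blast
  moreover have "card {w. v \<rightarrow>\<^bsub>G\<^esub> w} = card (verts G) - 3"
    using card_out_nbhd_eq_out_degree[OF nomulti_digraph_axioms] assms(3,4)
    by (simp add: regular_graph_def)
  ultimately have "card (closed_nbhd G v) = Suc (card (verts G) - 3)"
    by (simp add: closed_nbhd_def)
  then show ?thesis
    using card_Diff_subset[OF finite_subset[OF sub finite_verts] sub] assms(2) by simp
qed

lemma regular_graph_neighbour_exists:
  assumes "graph G" and "regular_graph G k" and "k > 0" and "b \<in> verts G"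
  obtains u where "u \<rightarrow>\<^bsub>G\<^esub> b"
proof -
  interpret graph G by fact
  have "card {w. b \<rightarrow>\<^bsub>G\<^esub> w} > 0"
    using card_out_nbhd_eq_out_degree[OF nomulti_digraph_axioms] assms(2-4)
    by (simp add: regular_graph_def)
  then obtain u where "b \<rightarrow>\<^bsub>G\<^esub> u" by (fastforce simp: card_gt_0_iff)
  then show ?thesis using that graph_symmetric by blast
qed

text \<open>
  The vertex \<open>v\<close> that makes the first forcing step out of \<open>N[u]\<close> is the other end of the edge.
  Conversely, once that step is made, a single vertex is missing and it gets forced as well.
\<close>

lemma power_dominating_singleton_iff:
  assumes "graph G" and "card (verts G) > 3"
    and "regular_graph G (card (verts G) - 3)" and u: "u \<in> verts G"
  shows "power_dominating_set G {u} \<longleftrightarrow>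
           (\<exists>v. u \<rightarrow>\<^bsub>G\<^esub> v \<and> card (closed_nbhd G v - closed_nbhd G u) = 1)"
proof -
  interpret graph G by fact
  let ?N = "closed_nbhd G u"
  have sub: "?N \<subseteq> verts G" using closed_nbhd_subset_verts wf_digraph_axioms u by metis
  have out: "card (verts G - ?N) = 2"
    using card_outside_closed_nbhd[OF digraph_axioms] assms(2-4) by simp
  have pds: "power_dominating_set G {u} \<longleftrightarrow> cl G ?N = verts G"
    using u by (simp add: power_dominating_set_def closed_nbhd_set_def)
  have escape: "closed_nbhd G v - ?N = {x. v \<rightarrow>\<^bsub>G\<^esub> x \<and> x \<notin> ?N}" if "v \<in> ?N" for v
    using that by (auto simp: closed_nbhd_def[of G v])
  show ?thesis
    unfolding pds
  proof
    assume "cl G ?N = verts G"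
    moreover have "?N \<noteq> verts G" using out by auto
    ultimately obtain B where "forces G ?N B"
      using cl_eq_self_if_no_force[OF finite_verts wf_digraph_axioms sub] by auto
    then obtain v w where v: "v \<in> ?N" and w: "{x. v \<rightarrow>\<^bsub>G\<^esub> x \<and> x \<notin> ?N} = {w}"
      unfolding forces_def by blast
    have "v \<noteq> u" using w by (auto simp: closed_nbhd_def)
    then have "u \<rightarrow>\<^bsub>G\<^esub> v" using v by (simp add: closed_nbhd_def)
    moreover have "card (closed_nbhd G v - ?N) = 1" using escape[OF v] w by simp
    ultimately show "\<exists>v. u \<rightarrow>\<^bsub>G\<^esub> v \<and> card (closed_nbhd G v - ?N) = 1" by blast
  next
    assume "\<exists>v. u \<rightarrow>\<^bsub>G\<^esub> v \<and> card (closed_nbhd G v - ?N) = 1"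
    then obtain v w where uv: "u \<rightarrow>\<^bsub>G\<^esub> v" and w: "closed_nbhd G v - ?N = {w}"
      by (meson card_1_singletonE)
    have v: "v \<in> ?N" using uv by (simp add: closed_nbhd_def)
    then have vw: "{x. v \<rightarrow>\<^bsub>G\<^esub> x \<and> x \<notin> ?N} = {w}" using escape w by simp
    then have step: "forces G ?N (insert w ?N)" using v unfolding forces_def by blast
    have wV: "w \<in> verts G - ?N" using vw adj_in_verts(2) by blast
    have "verts G - insert w ?N = (verts G - ?N) - {w}" by blast
    then have "card (verts G - insert w ?N) = 1" using out wV by simp
    then obtain b where b: "verts G - insert w ?N = {b}" by (meson card_1_singletonE)
    then obtain z where "z \<rightarrow>\<^bsub>G\<^esub> b"
      using regular_graph_neighbour_exists[OF assms(1,3)] assms(2) by (metis DiffD1 singletonI zero_less_diff)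
    then have "cl G (insert w ?N) = verts G"
      using cl_eq_verts_if_one_missing[OF finite_verts loopfree_digraph_axioms, of "insert w ?N" b z]
        sub wV b by blast
    then show "cl G ?N = verts G"
      using cl_forces_step[OF finite_verts wf_digraph_axioms sub step] by simp
  qed
qed

text \<open>Adding to \<open>u\<close> one of the two vertices it does not dominate leaves at most one undominated.\<close>

lemma power_domination_number_le_2:
  assumes "graph G" and "card (verts G) > 3" and "regular_graph G (card (verts G) - 3)"
  shows "power_domination_number G \<le> 2"
proof -
  interpret graph G by fact
  obtain u where u: "u \<in> verts G" using assms(2) by fastforce
  have "card (verts G - closed_nbhd G u) = 2"
    using card_outside_closed_nbhd[OF digraph_axioms] assms(2,3) u by simp
  then obtain a b where ab: "verts G - closed_nbhd G u = {a, b}" "a \<noteq> b" by (meson card_2_iff)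
  let ?U = "closed_nbhd_set G {u, a}"
  have aV: "a \<in> verts G" and bV: "b \<in> verts G" using ab by blast+
  obtain z where "z \<rightarrow>\<^bsub>G\<^esub> b"
    using regular_graph_neighbour_exists[OF assms(1,3) _ bV] assms(2) by auto
  moreover have "?U \<subseteq> verts G"
    using closed_nbhd_subset_verts[OF wf_digraph_axioms] u aV by (auto simp: closed_nbhd_set_def)
  moreover have "verts G \<subseteq> insert b ?U"
    using ab by (auto simp: closed_nbhd_set_def closed_nbhd_def[of G a])
  ultimately have "cl G ?U = verts G"
    using cl_eq_verts_if_one_missing[OF finite_verts loopfree_digraph_axioms] by blast
  then have "power_dominating_set G {u, a}" using u aV by (simp add: power_dominating_set_def)
  then have "power_domination_number G \<le> card {u, a}"
    using power_domination_number_le[OF finite_verts] by blast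
  also have "\<dots> \<le> 2" by (simp add: card_insert_if)
  finally show ?thesis .
qed

theorem theorem16:
  fixes G :: "('a, 'b) pre_digraph" and n :: nat
  assumes "graph G"
    and "connected G"
    and "card (verts G) = n"
    and "n \<ge> 5"
    and "regular_graph G (n - 3)"
  shows "(power_domination_number G = 1 \<longleftrightarrow>
            (\<exists>u v. u \<rightarrow>\<^bsub>G\<^esub> v \<and> card (closed_nbhd G v - closed_nbhd G u) = 1))
       \<and> ((\<nexists>u v. u \<rightarrow>\<^bsub>G\<^esub> v \<and> card (closed_nbhd G v - closed_nbhd G u) = 1) \<longrightarrow>
            power_domination_number G = 2)"
proof -
  interpret graph G by fact
  have card: "card (verts G) > 3" and reg: "regular_graph G (card (verts G) - 3)"
    using assms(3-5) by auto
  then have ne: "verts G \<noteq> {}" by auto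
  have one: "power_domination_number G = 1 \<longleftrightarrow>
      (\<exists>u v. u \<rightarrow>\<^bsub>G\<^esub> v \<and> card (closed_nbhd G v - closed_nbhd G u) = 1)"
    unfolding power_domination_number_eq_1_iff[OF finite_verts wf_digraph_axioms ne]
    using power_dominating_singleton_iff[OF assms(1) card reg] adj_in_verts(1)
    by (metis insert_subset power_dominating_set_def)
  have "power_domination_number G \<ge> 1" and "power_domination_number G \<le> 2"
    using power_domination_number_pos[OF finite_verts wf_digraph_axioms ne]
      power_domination_number_le_2[OF assms(1) card reg] by auto
  then have "power_domination_number G = 2" if "power_domination_number G \<noteq> 1"
    using that by linarith
  with one show ?thesis by blast
qed

end
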